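(* Let $X$ be a countably based topological space and let $\Gamma$ be any one of the families ${\bf\Sigma}^0_\alpha$, ${\bf\Pi}^0_\alpha$ ($\alpha<\omega_1$), ${\bf\Sigma}^{-1,\theta}_\alpha$, ${\bf\Pi}^{-1,\theta}_\alpha$ ($\alpha<\omega_1$, $0<\theta<\omega_1$), ${\bf\Sigma}^1_n$, ${\bf\Pi}^1_n$ ($1\leq n<\omega$). Then every principal $\Gamma$-TR of $\Gamma(X)$ is precomplete.
   Context: $\mathcal{N}=\omega^\omega$ is the Baire space. Borel hierarchy on any space $Y$: ${\bf\Sigma}^0_0(Y)=\{\emptyset\}$; ${\bf\Sigma}^0_1(Y)$ = open sets; ${\bf\Sigma}^0_2(Y)$ = countable unions of finite Boolean combinations of open sets; for $\alpha>2$, ${\bf\Sigma}^0_\alpha(Y)$ = countable unions of sets in $\bigcup_{\beta<\alpha}{\bf\Pi}^0_\beta(Y)$, ${\bf\Pi}^0_\beta$ being the complements of ${\bf\Sigma}^0_\beta$ sets. Difference hierarchy: with $r(\alpha)\in\{0,1\}$ the parity of the finite part of $\alpha$ (ordinal $\lambda+n$, $\lambda$ zero or limit), $D_\alpha(\{A_\beta\}_{\beta<\alpha})=\bigcup\{A_\beta\setminus\bigcup_{\gamma<\beta}A_\gamma\mid\beta<\alpha,r(\beta)\neq r(\alpha)\}$, ${\bf\Sigma}^{-1,\theta}_\alpha(Y)=\{D_\alpha(\{A_\beta\})\mid A_\beta\in{\bf\Sigma}^0_\theta(Y)\}$, ${\bf\Pi}^{-1,\theta}_\alpha(Y)$ its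 complements. Projective hierarchy: ${\bf\Sigma}^1_1(Y)$ = projections to $Y$ of ${\bf\Pi}^0_2(\mathcal{N}\times Y)$ sets, ${\bf\Sigma}^1_{n+1}(Y)$ = projections to $Y$ of ${\bf\Pi}^1_n(\mathcal{N}\times Y)$ sets, ${\bf\Pi}^1_n$ = complements. A TR is a function with domain $\mathcal{N}$; $\mu\leq\nu$ iff $\mu=\nu\circ f$ for a continuous $f$ on $\mathcal{N}$. A $\Gamma$-TR of $\Gamma(X)$ is a map $\nu:\mathcal{N}\to\Gamma(X)$ with $\{(a,x)\mid x\in\nu(a)\}\in\Gamma(\mathcal{N}\times X)$; it is principal if every $\Gamma$-TR $\mu:\mathcal{N}\to\Gamma(X)$ satisfies $\mu\leq\nu$. A TR $\nu$ is precomplete if for every partial continuous function $\psi$ from $\mathcal{N}$ to $\mathcal{N}$ there is a total continuous $g:\mathcal{N}\to\mathcal{N}$ with $\nu(\psi(x))=\nu(g(x))$ for all $x\in dom(\psi)$. *)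

theory Defs
  imports "HOL-Analysis.Analysis"
begin

unbundle cardinal_syntax

text \<open>The type of all ordinals below \<open>\<omega>\<^sub>1\<close>: \<open>cardSuc natLeq\<close> is a well-order of order type \<open>\<omega>\<^sub>1\<close>.\<close>

typedef omega1 = "Field (cardSuc natLeq)"
proof -
  have "Field (cardSuc natLeq) \<noteq> {}"
    using Field_cardSuc_not_empty[OF natLeq_Card_order] .
  then show ?thesis by blast
qed

lemma Well_order_cardSuc_natLeq: "Well_order (cardSuc natLeq)"
  using cardSuc_Card_order[OF natLeq_Card_order] by (rule card_order_on_well_order_on)

instantiation omega1 :: wellorder
begin

definition less_eq_omega1 :: "omega1 \<Rightarrow> omega1 \<Rightarrow> bool" where
  "\<alpha> \<le> \<beta> \<longleftrightarrow> (Rep_omega1 \<alpha>, Rep_omega1 \<beta>) \<in> cardSuc natLeq"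

definition less_omega1 :: "omega1 \<Rightarrow> omega1 \<Rightarrow> bool" where
  "\<alpha> < \<beta> \<longleftrightarrow> \<alpha> \<le> \<beta> \<and> \<not> \<beta> \<le> (\<alpha> :: omega1)"

instance
proof
  note W = Well_order_cardSuc_natLeq[unfolded well_order_on_def linear_order_on_def
      partial_order_on_def preorder_on_def]
  fix \<alpha> \<beta> \<gamma> :: omega1
  show "\<alpha> < \<beta> \<longleftrightarrow> \<alpha> \<le> \<beta> \<and> \<not> \<beta> \<le> \<alpha>" by (rule less_omega1_def)
  show "\<alpha> \<le> \<alpha>"
    using W Rep_omega1[of \<alpha>] by (auto simp: less_eq_omega1_def refl_on_def)
  show "\<alpha> \<le> \<gamma>" if "\<alpha> \<le> \<beta>" "\<beta> \<le> \<gamma>"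
    using W that unfolding less_eq_omega1_def by (meson transD)
  show "\<alpha> = \<beta>" if "\<alpha> \<le> \<beta>" "\<beta> \<le> \<alpha>"
    using W that unfolding less_eq_omega1_def by (meson antisymD Rep_omega1_inject)
  show "\<alpha> \<le> \<beta> \<or> \<beta> \<le> \<alpha>"
  proof (cases "\<alpha> = \<beta>")
    case True
    then show ?thesis
      using W Rep_omega1[of \<alpha>] by (auto simp: less_eq_omega1_def refl_on_def)
  next
    case False
    then have "Rep_omega1 \<alpha> \<noteq> Rep_omega1 \<beta>" by (simp add: Rep_omega1_inject)
    then show ?thesis
      using W Rep_omega1[of \<alpha>] Rep_omega1[of \<beta>]
      unfolding less_eq_omega1_def total_on_def by blast
  qed
next
  fix P :: "omega1 \<Rightarrow> bool" and \<alpha> :: omega1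
  assume step: "\<And>x. (\<And>y. y < x \<Longrightarrow> P y) \<Longrightarrow> P x"
  note W = Well_order_cardSuc_natLeq[unfolded well_order_on_def linear_order_on_def
      partial_order_on_def preorder_on_def]
  have "wf (inv_image (cardSuc natLeq - Id) Rep_omega1)"
    using W by (intro wf_inv_image) blast
  moreover have "(y, x) \<in> inv_image (cardSuc natLeq - Id) Rep_omega1 \<longleftrightarrow> y < x" for x y :: omega1
  proof -
    have "y < x \<longleftrightarrow> y \<le> x \<and> y \<noteq> x"
      using W unfolding less_omega1_def less_eq_omega1_def
      by (metis antisymD Rep_omega1_inject)
    then show ?thesis by (auto simp: inv_image_def less_eq_omega1_def Rep_omega1_inject)
  qed
  ultimately show "P \<alpha>"
    using step by (metis wf_induct_rule)
qed

end

lemma countable_iff_ordLeq_natLeq: "countable A \<longleftrightarrow> |A| \<le>o natLeq"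
proof -
  have "countable A \<longleftrightarrow> |A| \<le>o |UNIV :: nat set|"
    by (auto simp: countable_def card_of_ordLeq[symmetric])
  then show ?thesis
    using card_of_nat ordIso_symmetric ordLeq_ordIso_trans by blast
qed

lemma countable_lessThan_omega1: "countable {..<\<alpha> :: omega1}"
proof -
  let ?r = "cardSuc natLeq"
  have "|underS ?r (Rep_omega1 \<alpha>)| <o ?r"
    by (intro card_of_underS cardSuc_Card_order natLeq_Card_order Rep_omega1)
  then have "countable (underS ?r (Rep_omega1 \<alpha>))"
    by (simp add: countable_iff_ordLeq_natLeq cardSuc_ordLeq_ordLess natLeq_Card_order card_of_Card_order)
  moreover have "Rep_omega1 ` {..<\<alpha>} \<subseteq> underS ?r (Rep_omega1 \<alpha>)"
    by (auto simp: underS_def less_le less_eq_omega1_def Rep_omega1_inject)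
  ultimately have "countable (Rep_omega1 ` {..<\<alpha>})"
    by (rule countable_subset[rotated])
  then show ?thesis
    by (rule countable_image_inj_on) (auto simp: inj_on_def Rep_omega1_inject)
qed

lemma uncountable_omega1: "uncountable (UNIV :: omega1 set)"
proof
  assume "countable (UNIV :: omega1 set)"
  then have "countable (range Rep_omega1)" by (rule countable_image)
  then have "|Field (cardSuc natLeq)| \<le>o natLeq"
    using type_definition.Rep_range[OF type_definition_omega1]
    by (simp add: countable_iff_ordLeq_natLeq)
  moreover have "(card_of (Field (cardSuc natLeq)), cardSuc natLeq) \<in> ordIso"
    by (intro card_of_Field_ordIso cardSuc_Card_order natLeq_Card_order)
  ultimately have "cardSuc natLeq \<le>o natLeq"
    using ordIso_ordLeq_trans ordIso_symmetric by blast
  then show False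
    using cardSuc_greater[OF natLeq_Card_order] not_ordLess_ordLeq by blast
qed

unbundle no cardinal_syntax

instantiation omega1 :: zero
begin
definition zero_omega1 :: omega1 where "0 = (LEAST \<alpha> :: omega1. True)"
instance ..
end

text \<open>The successor ordinal; \<open>osuc 0\<close> and \<open>osuc (osuc 0)\<close> are the ordinals 1 and 2.\<close>

definition osuc :: "omega1 \<Rightarrow> omega1" where
  "osuc \<alpha> = (LEAST \<beta>. \<alpha> < \<beta>)"

lemma zero_le_omega1 [simp]: "0 \<le> (\<alpha> :: omega1)"
  unfolding zero_omega1_def by (rule Least_le) simp

lemma ex_greater_omega1: "\<exists>\<beta>. \<alpha> < (\<beta> :: omega1)"
proof (rule ccontr)
  assume "\<not> ?thesis"
  then have "(UNIV :: omega1 set) \<subseteq> insert \<alpha> {..<\<alpha>}" by (metis insert_iff lessThan_iff linorder_neqE subsetI)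
  then have "countable (UNIV :: omega1 set)"
    by (rule countable_subset) (simp add: countable_lessThan_omega1)
  then show False using uncountable_omega1 by simp
qed

lemma less_osuc [simp]: "\<alpha> < osuc \<alpha>"
  unfolding osuc_def using ex_greater_omega1 by (rule LeastI_ex)

lemma osuc_le_iff: "osuc \<alpha> \<le> \<beta> \<longleftrightarrow> \<alpha> < \<beta>"
  using less_osuc[of \<alpha>] by (auto simp: osuc_def Least_le intro: less_le_trans)

lemma less_osuc_iff: "\<beta> < osuc \<alpha> \<longleftrightarrow> \<beta> \<le> \<alpha>"
  using osuc_le_iff[of \<alpha> \<beta>] by (auto simp: not_less[symmetric])

lemma osuc_inject: "osuc \<alpha> = osuc \<beta> \<longleftrightarrow> \<alpha> = \<beta>"
  by (metis less_osuc less_osuc_iff order_antisym)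

definition zero_or_limit :: "omega1 \<Rightarrow> bool" where
  "zero_or_limit l \<longleftrightarrow> (\<forall>\<beta><l. osuc \<beta> < l)"

lemma not_zero_or_limit_osuc: "\<not> zero_or_limit (osuc \<alpha>)"
  unfolding zero_or_limit_def using less_osuc by blast

lemma ex_fin_part: "\<exists>n l. zero_or_limit l \<and> \<alpha> = (osuc ^^ n) l"
proof (induction \<alpha> rule: less_induct)
  case (less \<alpha>)
  show ?case
  proof (cases "zero_or_limit \<alpha>")
    case True
    then show ?thesis by (intro exI[of _ 0] exI[of _ \<alpha>]) simp
  next
    case False
    then obtain \<beta> where \<beta>: "\<beta> < \<alpha>" "\<not> osuc \<beta> < \<alpha>" by (auto simp: zero_or_limit_def)
    then have "\<alpha> = osuc \<beta>" using osuc_le_iff[of \<beta> \<alpha>] by auto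
    with less.IH[OF \<beta>(1)] obtain n l where "zero_or_limit l" "\<alpha> = (osuc ^^ Suc n) l" by auto
    then show ?thesis by blast
  qed
qed

lemma fin_part_unique:
  assumes "zero_or_limit l" "zero_or_limit l'" "(osuc ^^ n) l = (osuc ^^ m) l'"
  shows "n = m"
  using assms(3)
proof (induction n arbitrary: m)
  case 0
  then show ?case using assms(1) not_zero_or_limit_osuc by (cases m) auto
next
  case (Suc n)
  then show ?case using assms(2) not_zero_or_limit_osuc by (cases m) (auto simp: osuc_inject)
qed

text \<open>The \<open>n\<close> in the unique representation \<open>\<alpha> = l + n\<close> with \<open>l\<close> zero or limit.\<close>

definition fin_part :: "omega1 \<Rightarrow> nat" where
  "fin_part \<alpha> = (THE n. \<exists>l. zero_or_limit l \<and> \<alpha> = (osuc ^^ n) l)"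

lemma fin_part_eq: "zero_or_limit l \<Longrightarrow> fin_part ((osuc ^^ n) l) = n"
  unfolding fin_part_def by (rule the_equality) (auto dest: fin_part_unique)

definition ord_parity :: "omega1 \<Rightarrow> nat" where
  "ord_parity \<alpha> = fin_part \<alpha> mod 2"

inductive_set bool_comb :: "'a topology \<Rightarrow> 'a set set" for Y :: "'a topology" where
  opn: "openin Y U \<Longrightarrow> U \<in> bool_comb Y"
| compl: "A \<in> bool_comb Y \<Longrightarrow> topspace Y - A \<in> bool_comb Y"
| union: "A \<in> bool_comb Y \<Longrightarrow> B \<in> bool_comb Y \<Longrightarrow> A \<union> B \<in> bool_comb Y"
| inter: "A \<in> bool_comb Y \<Longrightarrow> B \<in> bool_comb Y \<Longrightarrow> A \<inter> B \<in> bool_comb Y"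

definition complements :: "'a topology \<Rightarrow> 'a set set \<Rightarrow> 'a set set" where
  "complements Y C = (\<lambda>A. topspace Y - A) ` C"

function Sigma0 :: "omega1 \<Rightarrow> 'a topology \<Rightarrow> 'a set set" where
  "Sigma0 \<alpha> Y =
    (if \<alpha> = 0 then {{}}
     else if \<alpha> = osuc 0 then {U. openin Y U}
     else if \<alpha> = osuc (osuc 0) then {\<Union>C | C. countable C \<and> C \<subseteq> bool_comb Y}
     else {\<Union>C | C. countable C \<and> C \<subseteq> (\<Union>\<beta>\<in>{..<\<alpha>}. complements Y (Sigma0 \<beta> Y))})"
  by pat_completeness auto
termination
  by (relation "{(\<beta>, \<alpha>). \<beta> < \<alpha>} <*lex*> {}") (auto intro: wf)

declare Sigma0.simps [simp del]

definition Pi0 :: "omega1 \<Rightarrow> 'a topology \<Rightarrow> 'a set set" where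
  "Pi0 \<alpha> Y = complements Y (Sigma0 \<alpha> Y)"

definition diff_op :: "omega1 \<Rightarrow> (omega1 \<Rightarrow> 'a set) \<Rightarrow> 'a set" where
  "diff_op \<alpha> A = (\<Union>\<beta> \<in> {\<beta>. \<beta> < \<alpha> \<and> ord_parity \<beta> \<noteq> ord_parity \<alpha>}. A \<beta> - (\<Union>\<gamma>\<in>{..<\<beta>}. A \<gamma>))"

definition SigmaD :: "omega1 \<Rightarrow> omega1 \<Rightarrow> 'a topology \<Rightarrow> 'a set set" where
  "SigmaD \<theta> \<alpha> Y = {diff_op \<alpha> A | A. \<forall>\<beta><\<alpha>. A \<beta> \<in> Sigma0 \<theta> Y}"

definition PiD :: "omega1 \<Rightarrow> omega1 \<Rightarrow> 'a topology \<Rightarrow> 'a set set" where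
  "PiD \<theta> \<alpha> Y = complements Y (SigmaD \<theta> \<alpha> Y)"

type_synonym baire = "nat \<Rightarrow> nat"

definition baire :: "baire topology" where
  "baire = product_topology (\<lambda>_. discrete_topology UNIV) UNIV"

text \<open>
  The usual recursion for the projective classes passes from a space \<open>Y\<close> to the product of
  the Baire space with \<open>Y\<close>, whose points have a different type.  To keep the types fixed, the
  recursion is carried out on all spaces \<open>baire_pow m Y\<close> (the product of \<open>m\<close> copies of the Baire
  space with \<open>Y\<close>) simultaneously.  \<open>Pi1_pow n m Y\<close> is the n-th level on \<open>baire_pow m Y\<close>, with
  level 0 being the boldface \<open>\<Pi>\<^sup>0\<^sub>2\<close> sets.  The lemmas \<open>Sigma1_one\<close> and \<open>Sigma1_Suc\<close>
  below show that the literal recursion equations hold.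
\<close>

definition baire_pow :: "nat \<Rightarrow> 'a topology \<Rightarrow> ((nat \<Rightarrow> baire) \<times> 'a) topology" where
  "baire_pow m Y = prod_topology (product_topology (\<lambda>_. baire) {..<m}) Y"

definition forget_last :: "nat \<Rightarrow> (nat \<Rightarrow> baire) \<times> 'a \<Rightarrow> (nat \<Rightarrow> baire) \<times> 'a" where
  "forget_last m = (\<lambda>(s, y). (restrict s {..<m}, y))"

primrec Pi1_pow :: "nat \<Rightarrow> nat \<Rightarrow> 'a topology \<Rightarrow> ((nat \<Rightarrow> baire) \<times> 'a) set set" where
  "Pi1_pow 0 m Y = Pi0 (osuc (osuc 0)) (baire_pow m Y)"
| "Pi1_pow (Suc n) m Y = complements (baire_pow m Y) ((\<lambda>B. forget_last m ` B) ` Pi1_pow n (Suc m) Y)"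

definition Sigma1 :: "nat \<Rightarrow> 'a topology \<Rightarrow> 'a set set" where
  "Sigma1 n Y = (\<lambda>B. snd ` B) ` Pi1_pow (n - 1) 1 Y"

definition Pi1 :: "nat \<Rightarrow> 'a topology \<Rightarrow> 'a set set" where
  "Pi1 n Y = complements Y (Sigma1 n Y)"

lemma bool_comb_subset: "A \<in> bool_comb Y \<Longrightarrow> A \<subseteq> topspace Y"
  by (induction rule: bool_comb.induct) (auto dest: openin_subset)

lemma Sigma0_subset: "A \<in> Sigma0 \<alpha> Y \<Longrightarrow> A \<subseteq> topspace Y"
  by (subst (asm) Sigma0.simps)
    (auto split: if_splits simp: complements_def dest: openin_subset bool_comb_subset)

lemma Pi0_subset: "A \<in> Pi0 \<alpha> Y \<Longrightarrow> A \<subseteq> topspace Y"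
  by (auto simp: Pi0_def complements_def)

lemma Pi1_pow_subset: "A \<in> Pi1_pow n m Y \<Longrightarrow> A \<subseteq> topspace (baire_pow m Y)"
  by (cases n) (auto simp: complements_def dest: Pi0_subset)

lemma image_topspace_Diff:
  assumes "homeomorphic_maps Y Z f g" "A \<subseteq> topspace Y"
  shows "f ` (topspace Y - A) = topspace Z - f ` A"
proof -
  have "inj_on f (topspace Y)" "f ` topspace Y = topspace Z"
    using assms(1) homeomorphic_maps_map homeomorphic_map_def
    by (auto simp: homeomorphic_eq_everything_map homeomorphic_maps_map)
  then show ?thesis
    using assms(2) by (metis inj_on_image_set_diff Diff_subset)
qed

lemma bool_comb_image:
  assumes h: "homeomorphic_maps Y Z f g" and A: "A \<in> bool_comb Y"
  shows "f ` A \<in> bool_comb Z"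
  using A
proof (induction rule: bool_comb.induct)
  case (opn U)
  then have "openin Z (f ` U)"
    using h by (meson homeomorphic_maps_map homeomorphic_map_openness_eq)
  then show ?case by (rule bool_comb.opn)
next
  case (compl A)
  then show ?case
    using image_topspace_Diff[OF h bool_comb_subset] by (metis bool_comb.compl)
next
  case (union A B)
  then show ?case by (simp add: image_Un bool_comb.union)
next
  case (inter A B)
  have "inj_on f (topspace Y)"
    using h by (simp add: homeomorphic_eq_everything_map homeomorphic_maps_map)
  then have "f ` (A \<inter> B) = f ` A \<inter> f ` B"
    using inter bool_comb_subset by (metis inj_on_image_Int)
  then show ?case using inter by (simp add: bool_comb.inter)
qed

lemma Sigma0_image:
  assumes h: "homeomorphic_maps Y Z f g" and A: "A \<in> Sigma0 \<alpha> Y"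
  shows "f ` A \<in> Sigma0 \<alpha> Z"
  using A
proof (induction \<alpha> arbitrary: A rule: less_induct)
  case (less \<alpha>)
  consider "\<alpha> = 0" | "\<alpha> \<noteq> 0" "\<alpha> = osuc 0" | "\<alpha> \<noteq> 0" "\<alpha> \<noteq> osuc 0" "\<alpha> = osuc (osuc 0)"
    | "\<alpha> \<noteq> 0" "\<alpha> \<noteq> osuc 0" "\<alpha> \<noteq> osuc (osuc 0)" by blast
  then show ?case
  proof cases
    case 1
    then show ?thesis using less.prems by (simp add: Sigma0.simps)
  next
    case 2
    then have "openin Y A" using less.prems by (subst (asm) Sigma0.simps) simp
    then have "openin Z (f ` A)"
      using h by (meson homeomorphic_maps_map homeomorphic_map_openness_eq)
    then show ?thesis using 2 by (subst Sigma0.simps) simp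
  next
    case 3
    then obtain C where C: "A = \<Union>C" "countable C" "C \<subseteq> bool_comb Y"
      using less.prems by (subst (asm) Sigma0.simps) auto
    then have "f ` A = \<Union>((`) f ` C)" "countable ((`) f ` C)" "(`) f ` C \<subseteq> bool_comb Z"
      using bool_comb_image[OF h] by auto
    then show ?thesis using 3 by (subst Sigma0.simps) auto
  next
    case 4
    then obtain C where C: "A = \<Union>C" "countable C"
        "C \<subseteq> (\<Union>\<beta>\<in>{..<\<alpha>}. complements Y (Sigma0 \<beta> Y))"
      using less.prems by (subst (asm) Sigma0.simps) auto
    have "f ` B \<in> (\<Union>\<beta>\<in>{..<\<alpha>}. complements Z (Sigma0 \<beta> Z))" if B: "B \<in> C" for B
    proof -
      obtain \<beta> D where \<beta>: "\<beta> < \<alpha>" "D \<in> Sigma0 \<beta> Y" "B = topspace Y - D"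
        using C(3) B by (auto simp: complements_def)
      then have "f ` B = topspace Z - f ` D"
        using image_topspace_Diff[OF h Sigma0_subset] by blast
      then show ?thesis
        using \<beta>(1) less.IH[OF \<beta>(1,2)] unfolding complements_def by blast
    qed
    then have "f ` A = \<Union>((`) f ` C)" "countable ((`) f ` C)"
        "(`) f ` C \<subseteq> (\<Union>\<beta>\<in>{..<\<alpha>}. complements Z (Sigma0 \<beta> Z))"
      using C by auto
    then show ?thesis using 4 by (subst Sigma0.simps) auto
  qed
qed

lemma Pi0_image:
  assumes h: "homeomorphic_maps Y Z f g" and B: "B \<in> Pi0 \<alpha> Y"
  shows "f ` B \<in> Pi0 \<alpha> Z"
proof -
  obtain A where A: "A \<in> Sigma0 \<alpha> Y" "B = topspace Y - A"
    using B by (auto simp: Pi0_def complements_def)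
  then have "f ` B = topspace Z - f ` A"
    using image_topspace_Diff[OF h Sigma0_subset] by blast
  then show ?thesis
    using Sigma0_image[OF h A(1)] unfolding Pi0_def complements_def by blast
qed

lemma Pi0_image_eq:
  assumes h: "homeomorphic_maps Y Z f g"
  shows "(\<lambda>B. f ` B) ` Pi0 \<alpha> Y = Pi0 \<alpha> Z"
proof -
  have "B \<in> (\<lambda>B. f ` B) ` Pi0 \<alpha> Y" if B: "B \<in> Pi0 \<alpha> Z" for B
  proof
    have g: "homeomorphic_maps Z Y g f" using h by (subst homeomorphic_maps_sym)
    have "B \<subseteq> topspace Z" using B by (rule Pi0_subset)
    then have "\<forall>b\<in>B. f (g b) = b" using h by (auto simp: homeomorphic_maps_def)
    then show "B = f ` (g ` B)" by (simp add: image_image)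
    show "g ` B \<in> Pi0 \<alpha> Y"
      by (rule Pi0_image[OF g B])
  qed
  then show ?thesis using Pi0_image[OF h] by blast
qed

lemma topspace_baire [simp]: "topspace baire = UNIV"
  by (simp add: baire_def)

lemma topspace_baire_pow: "topspace (baire_pow m Y) = extensional {..<m} \<times> topspace Y"
  by (auto simp: baire_pow_def PiE_def)

definition shift_in :: "nat \<Rightarrow> (nat \<Rightarrow> baire) \<times> baire \<times> 'a \<Rightarrow> (nat \<Rightarrow> baire) \<times> 'a" where
  "shift_in m = (\<lambda>(s, a, y). (\<lambda>i\<in>{..<Suc m}. if i = 0 then a else s (i - 1), y))"

definition shift_out :: "nat \<Rightarrow> (nat \<Rightarrow> baire) \<times> 'a \<Rightarrow> (nat \<Rightarrow> baire) \<times> baire \<times> 'a" where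
  "shift_out m = (\<lambda>(s, y). (\<lambda>i\<in>{..<m}. s (Suc i), s 0, y))"

lemma homeomorphic_shift:
  "homeomorphic_maps (baire_pow m (prod_topology baire Y)) (baire_pow (Suc m) Y) (shift_in m) (shift_out m)"
proof -
  let ?P = "\<lambda>m. product_topology (\<lambda>_. baire) {..<m}"
  have 1: "continuous_map (baire_pow m (prod_topology baire Y)) (baire_pow (Suc m) Y) (shift_in m)"
  proof -
    have "continuous_map (baire_pow m (prod_topology baire Y)) baire
        (\<lambda>x. if i = 0 then fst (snd x) else fst x (i - 1))" if "i < Suc m" for i
    proof (cases "i = 0")
      case True
      then show ?thesis unfolding baire_pow_def
        by (auto intro!: continuous_map_fst_of continuous_map_compose[OF continuous_map_snd continuous_map_fst, unfolded o_def])
    next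
      case False
      then have "continuous_map (?P m) baire (\<lambda>s. s (i - 1))"
        using that by (intro continuous_map_product_projection) auto
      then have "continuous_map (baire_pow m (prod_topology baire Y)) baire (\<lambda>x. fst x (i - 1))"
        unfolding baire_pow_def
        by (rule continuous_map_compose[OF continuous_map_fst, unfolded o_def])
      then show ?thesis using False by simp
    qed
    moreover have "continuous_map (baire_pow m (prod_topology baire Y)) Y (\<lambda>x. snd (snd x))"
      unfolding baire_pow_def
      by (rule continuous_map_compose[OF continuous_map_snd continuous_map_snd, unfolded o_def])
    ultimately show ?thesis
      unfolding baire_pow_def[of "Suc m"] shift_in_def case_prod_unfold
      by (auto simp: continuous_map_paired continuous_map_componentwise extensional_def)
  qed
  have 2: "continuous_map (baire_pow (Suc m) Y) (baire_pow m (prod_topology baire Y)) (shift_out m)"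
  proof -
    have "continuous_map (baire_pow (Suc m) Y) baire (\<lambda>x. fst x i)" if "i < Suc m" for i
    proof -
      have "continuous_map (?P (Suc m)) baire (\<lambda>s. s i)"
        using that by (intro continuous_map_product_projection) auto
      then show ?thesis unfolding baire_pow_def
        by (rule continuous_map_compose[OF continuous_map_fst, unfolded o_def])
    qed
    moreover have "continuous_map (baire_pow (Suc m) Y) Y snd"
      unfolding baire_pow_def by (rule continuous_map_snd)
    ultimately show ?thesis
      unfolding baire_pow_def[of m] shift_out_def case_prod_unfold
      by (auto simp: continuous_map_paired continuous_map_componentwise extensional_def)
  qed
  show ?thesis
    unfolding homeomorphic_maps_def
    using 1 2
    by (auto simp: topspace_baire_pow shift_in_def shift_out_def fun_eq_iff extensional_def less_Suc_eq_0_disj)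
qed

lemma forget_shift:
  "forget_last (Suc m) (shift_in (Suc m) x) = shift_in m (forget_last m x)"
  by (cases x) (auto simp: forget_last_def shift_in_def fun_eq_iff)

lemma Pi1_pow_shift:
  "(\<lambda>B. shift_in m ` B) ` Pi1_pow n m (prod_topology baire Y) = Pi1_pow n (Suc m) Y"
proof (induction n arbitrary: m)
  case 0
  then show ?case by (simp add: Pi0_image_eq[OF homeomorphic_shift])
next
  case (Suc n)
  let ?Z = "prod_topology baire Y"
  have *: "shift_in m ` (topspace (baire_pow m ?Z) - forget_last m ` B) =
      topspace (baire_pow (Suc m) Y) - forget_last (Suc m) ` shift_in (Suc m) ` B"
    if "B \<in> Pi1_pow n (Suc m) ?Z" for B
  proof -
    have "forget_last m ` B \<subseteq> topspace (baire_pow m ?Z)"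
      using Pi1_pow_subset[OF that] by (auto simp: forget_last_def topspace_baire_pow)
    then have "shift_in m ` (topspace (baire_pow m ?Z) - forget_last m ` B) =
        topspace (baire_pow (Suc m) Y) - shift_in m ` forget_last m ` B"
      by (rule image_topspace_Diff[OF homeomorphic_shift])
    then show ?thesis by (simp add: image_image forget_shift)
  qed
  have "(\<lambda>B. shift_in m ` B) ` Pi1_pow (Suc n) m ?Z =
      (\<lambda>B. topspace (baire_pow (Suc m) Y) - forget_last (Suc m) ` B) `
        (\<lambda>B. shift_in (Suc m) ` B) ` Pi1_pow n (Suc m) ?Z"
    by (auto simp: complements_def image_image * cong: image_cong)
  then show ?case
    by (simp add: Suc complements_def image_image)
qed

lemma homeomorphic_baire_pow_0:
  "homeomorphic_maps (baire_pow 0 Y) Y snd (\<lambda>y. (\<lambda>_. undefined, y))"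
  unfolding homeomorphic_maps_def
  by (auto simp: baire_pow_def continuous_map_snd continuous_map_paired)

lemma snd_Pi1_pow_0: "(\<lambda>B. snd ` B) ` Pi1_pow 0 0 Y = Pi0 (osuc (osuc 0)) Y"
  by (simp add: Pi0_image_eq[OF homeomorphic_baire_pow_0])

lemma snd_Pi1_pow_Suc: "(\<lambda>B. snd ` B) ` Pi1_pow (Suc n) 0 Y = Pi1 (Suc n) Y"
proof -
  have "snd ` (topspace (baire_pow 0 Y) - forget_last 0 ` B) = topspace Y - snd ` B"
    if "B \<in> Pi1_pow n 1 Y" for B
  proof -
    have "forget_last 0 ` B \<subseteq> topspace (baire_pow 0 Y)"
      using Pi1_pow_subset[OF that] by (auto simp: forget_last_def topspace_baire_pow)
    then have "snd ` (topspace (baire_pow 0 Y) - forget_last 0 ` B) =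
        topspace Y - snd ` forget_last 0 ` B"
      by (rule image_topspace_Diff[OF homeomorphic_baire_pow_0])
    then show ?thesis by (simp add: image_image forget_last_def case_prod_unfold)
  qed
  then show ?thesis
    by (auto simp: Pi1_def Sigma1_def complements_def image_image cong: image_cong)
qed

lemma Sigma1_pow: "Sigma1 (Suc n) Y =
    (\<lambda>B. snd ` B) ` (\<lambda>B. snd ` B) ` Pi1_pow n 0 (prod_topology baire Y)"
proof -
  have "snd (shift_in 0 x) = snd (snd x)" for x :: "(nat \<Rightarrow> baire) \<times> baire \<times> 'a"
    by (cases x) (simp add: shift_in_def)
  then show ?thesis
    by (simp add: Sigma1_def Pi1_pow_shift[of 0, symmetric] image_image)
qed

theorem Sigma1_one:
  "Sigma1 1 Y = (\<lambda>B. snd ` B) ` Pi0 (osuc (osuc 0)) (prod_topology baire Y)"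
  using Sigma1_pow[of 0 Y] by (simp only: snd_Pi1_pow_0 One_nat_def)

theorem Sigma1_Suc:
  assumes "1 \<le> n"
  shows "Sigma1 (Suc n) Y = (\<lambda>B. snd ` B) ` Pi1 n (prod_topology baire Y)"
  using Sigma1_pow[of n Y] assms by (cases n) (simp_all only: snd_Pi1_pow_Suc)

datatype family =
    Sigma0_fam omega1
  | Pi0_fam omega1
  | SigmaD_fam omega1 omega1
  | PiD_fam omega1 omega1
  | Sigma1_fam nat
  | Pi1_fam nat

text \<open>In \<open>SigmaD_fam \<theta> \<alpha>\<close> and \<open>PiD_fam \<theta> \<alpha>\<close>, the base level \<open>\<theta>\<close> comes first.\<close>

primrec admissible :: "family \<Rightarrow> bool" where
  "admissible (Sigma0_fam \<alpha>) \<longleftrightarrow> True"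
| "admissible (Pi0_fam \<alpha>) \<longleftrightarrow> True"
| "admissible (SigmaD_fam \<theta> \<alpha>) \<longleftrightarrow> 0 < \<theta>"
| "admissible (PiD_fam \<theta> \<alpha>) \<longleftrightarrow> 0 < \<theta>"
| "admissible (Sigma1_fam n) \<longleftrightarrow> 1 \<le> n"
| "admissible (Pi1_fam n) \<longleftrightarrow> 1 \<le> n"

primrec pointclass :: "family \<Rightarrow> 'a topology \<Rightarrow> 'a set set" where
  "pointclass (Sigma0_fam \<alpha>) = Sigma0 \<alpha>"
| "pointclass (Pi0_fam \<alpha>) = Pi0 \<alpha>"
| "pointclass (SigmaD_fam \<theta> \<alpha>) = SigmaD \<theta> \<alpha>"
| "pointclass (PiD_fam \<theta> \<alpha>) = PiD \<theta> \<alpha>"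
| "pointclass (Sigma1_fam n) = Sigma1 n"
| "pointclass (Pi1_fam n) = Pi1 n"

definition TR_reducible :: "(baire \<Rightarrow> 'b) \<Rightarrow> (baire \<Rightarrow> 'b) \<Rightarrow> bool" where
  "TR_reducible \<mu> \<nu> \<longleftrightarrow> (\<exists>f. continuous_map baire baire f \<and> \<mu> = \<nu> \<circ> f)"

definition is_TR_of :: "family \<Rightarrow> 'a topology \<Rightarrow> (baire \<Rightarrow> 'a set) \<Rightarrow> bool" where
  "is_TR_of \<Gamma> X \<nu> \<longleftrightarrow> (\<forall>a. \<nu> a \<in> pointclass \<Gamma> X) \<and>
     {(a, x). x \<in> \<nu> a} \<in> pointclass \<Gamma> (prod_topology baire X)"

definition principal_TR_of :: "family \<Rightarrow> 'a topology \<Rightarrow> (baire \<Rightarrow> 'a set) \<Rightarrow> bool" where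
  "principal_TR_of \<Gamma> X \<nu> \<longleftrightarrow> is_TR_of \<Gamma> X \<nu> \<and> (\<forall>\<mu>. is_TR_of \<Gamma> X \<mu> \<longrightarrow> TR_reducible \<mu> \<nu>)"

definition precomplete :: "(baire \<Rightarrow> 'b) \<Rightarrow> bool" where
  "precomplete \<nu> \<longleftrightarrow> (\<forall>D \<psi>. continuous_map (subtopology baire D) baire \<psi> \<longrightarrow>
     (\<exists>g. continuous_map baire baire g \<and> (\<forall>a\<in>D. \<nu> (\<psi> a) = \<nu> (g a))))"

end

(* Let S be the domain of a partial continuous psi. Every pointclass in question is closed under
   continuous preimages, and its members on a subspace are exactly the traces of its members on the
   whole space. Hence the preimage of the graph of nu under (a, x) |-> (psi a, x), a member of the
   class on S x X, is the trace of some V in the class on N x X. The sections of V form a TR which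
   agrees with nu o psi on S, and a reduction of it to nu is the required total function. *)
theory Submission
  imports Defs
begin

section \<open>Unfolding the Borel recursion from level two on\<close>

lemma Sigma0_two:
  "Sigma0 (osuc (osuc 0)) Y = {\<Union>C | C. countable C \<and> C \<subseteq> bool_comb Y}"
proof -
  have "osuc (osuc 0) \<noteq> 0" "osuc (osuc 0) \<noteq> osuc 0"
    using less_osuc[of 0] less_osuc[of "osuc 0"] by (metis order_less_asym, metis order_less_irrefl)
  then show ?thesis by (subst Sigma0.simps) simp
qed

lemma Sigma0_greater_two:
  assumes "\<alpha> \<noteq> 0" "\<alpha> \<noteq> osuc 0" "\<alpha> \<noteq> osuc (osuc 0)"
  shows "Sigma0 \<alpha> Y =
    {\<Union>C | C. countable C \<and> C \<subseteq> (\<Union>\<beta>\<in>{..<\<alpha>}. complements Y (Sigma0 \<beta> Y))}"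
  using assms by (subst Sigma0.simps) simp

section \<open>Continuous preimages\<close>

text \<open>Continuity constrains \<open>f\<close> only on \<open>topspace Y\<close>, so the
  preimage is cut down to that set throughout. Compatibility with complements then rests on
  \<open>f\<close> sending \<open>topspace Y\<close> into \<open>topspace Z\<close>.\<close>

lemma vimage_topspace_Diff:
  assumes "continuous_map Y Z f"
  shows "f -` (topspace Z - A) \<inter> topspace Y = topspace Y - (f -` A \<inter> topspace Y)"
  using continuous_map_funspace[OF assms] by auto

text \<open>The families \<open>C\<close> and \<open>C'\<close> are left arbitrary so that one lemma
  serves the Borel, difference and projective classes, also inside their inductions.\<close>

lemma complements_vimage:
  assumes "continuous_map Y Z f" "A \<in> complements Z C"
    and "\<And>B. B \<in> C \<Longrightarrow> f -` B \<inter> topspace Y \<in> C'"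
  shows "f -` A \<inter> topspace Y \<in> complements Y C'"
  using assms vimage_topspace_Diff[OF assms(1)] by (force simp: complements_def)

lemma bool_comb_vimage:
  assumes f: "continuous_map Y Z f" and A: "A \<in> bool_comb Z"
  shows "f -` A \<inter> topspace Y \<in> bool_comb Y"
  using A
proof (induction rule: bool_comb.induct)
  case (opn U)
  then show ?case
    using f by (simp add: bool_comb.opn continuous_map_openin_preimage_eq Int_commute)
next
  case (compl A)
  then show ?case
    unfolding vimage_topspace_Diff[OF f] by (intro bool_comb.compl)
next
  case (union A B)
  then show ?case by (simp add: Int_Un_distrib2 bool_comb.union)
next
  case (inter A B)
  have "f -` (A \<inter> B) \<inter> topspace Y = (f -` A \<inter> topspace Y) \<inter> (f -` B \<inter> topspace Y)" by blast
  then show ?case using inter.IH by (simp only: bool_comb.inter)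
qed

lemma Sigma0_vimage:
  assumes f: "continuous_map Y Z f" and A: "A \<in> Sigma0 \<alpha> Z"
  shows "f -` A \<inter> topspace Y \<in> Sigma0 \<alpha> Y"
  using A
proof (induction \<alpha> arbitrary: A rule: less_induct)
  case (less \<alpha>)
  let ?g = "\<lambda>A. f -` A \<inter> topspace Y"
  consider "\<alpha> = 0" | "\<alpha> \<noteq> 0" "\<alpha> = osuc 0" | "\<alpha> = osuc (osuc 0)"
    | "\<alpha> \<noteq> 0" "\<alpha> \<noteq> osuc 0" "\<alpha> \<noteq> osuc (osuc 0)" by blast
  then show ?case
  proof cases
    case 1
    then show ?thesis using less.prems by (simp add: Sigma0.simps)
  next
    case 2
    then have "openin Z A" using less.prems by (subst (asm) Sigma0.simps) simp
    then have "openin Y (?g A)"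
      using f by (simp add: continuous_map_openin_preimage_eq Int_commute)
    then show ?thesis using 2 by (subst Sigma0.simps) simp
  next
    case 3
    then obtain C where C: "A = \<Union>C" "countable C" "C \<subseteq> bool_comb Z"
      using less.prems unfolding 3 Sigma0_two by blast
    then have "?g A = \<Union>(?g ` C)" "countable (?g ` C)" "?g ` C \<subseteq> bool_comb Y"
      using bool_comb_vimage[OF f] by auto
    then show ?thesis unfolding 3 Sigma0_two by blast
  next
    case 4
    then obtain C where C: "A = \<Union>C" "countable C"
        "C \<subseteq> (\<Union>\<beta>\<in>{..<\<alpha>}. complements Z (Sigma0 \<beta> Z))"
      using less.prems unfolding Sigma0_greater_two[OF 4] by blast
    have "?g B \<in> (\<Union>\<beta>\<in>{..<\<alpha>}. complements Y (Sigma0 \<beta> Y))" if B: "B \<in> C" for B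
    proof -
      obtain \<beta> where \<beta>: "\<beta> < \<alpha>" "B \<in> complements Z (Sigma0 \<beta> Z)"
        using C(3) B by auto
      then show ?thesis
        using complements_vimage[OF f \<beta>(2) less.IH[OF \<beta>(1)]] by blast
    qed
    then have "?g A = \<Union>(?g ` C)" "countable (?g ` C)"
        "?g ` C \<subseteq> (\<Union>\<beta>\<in>{..<\<alpha>}. complements Y (Sigma0 \<beta> Y))"
      using C by auto
    then show ?thesis unfolding Sigma0_greater_two[OF 4] by blast
  qed
qed

text \<open>Whether a point lies in \<open>diff_op \<alpha> B\<close> depends only on which
  \<open>B \<beta>\<close> contain it, so preimages may be taken term by term.\<close>

lemma SigmaD_vimage:
  assumes f: "continuous_map Y Z f" and A: "A \<in> SigmaD \<theta> \<alpha> Z"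
  shows "f -` A \<inter> topspace Y \<in> SigmaD \<theta> \<alpha> Y"
proof -
  obtain B where B: "A = diff_op \<alpha> B" "\<forall>\<beta><\<alpha>. B \<beta> \<in> Sigma0 \<theta> Z"
    using A by (auto simp: SigmaD_def)
  have "f -` A \<inter> topspace Y = diff_op \<alpha> (\<lambda>\<beta>. f -` B \<beta> \<inter> topspace Y)"
    by (auto simp: B(1) diff_op_def)
  then show ?thesis
    using B(2) Sigma0_vimage[OF f] unfolding SigmaD_def by blast
qed

lemma continuous_map_baire_pow:
  assumes "continuous_map Y Z f"
  shows "continuous_map (baire_pow m Y) (baire_pow m Z) (map_prod id f)"
  using assms unfolding baire_pow_def map_prod_def case_prod_unfold
  by (auto simp: continuous_map_paired continuous_map_fst
      intro: continuous_map_compose[OF continuous_map_snd, unfolded o_def])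

text \<open>The map acts on the base point alone and fixes the Baire coordinates over which the
  recursion projects. The induction varies \<open>m\<close>, since each level on \<open>m\<close>
  coordinates comes from the previous level on \<open>Suc m\<close>.\<close>

lemma Pi1_pow_vimage:
  assumes f: "continuous_map Y Z f" and "A \<in> Pi1_pow n m Z"
  shows "map_prod id f -` A \<inter> topspace (baire_pow m Y) \<in> Pi1_pow n m Y"
  using assms(2)
proof (induction n arbitrary: m A)
  case 0
  note g = continuous_map_baire_pow[OF f, of m]
  show ?case
    using 0 unfolding Pi1_pow.simps Pi0_def
    by (rule complements_vimage[OF g _ Sigma0_vimage[OF g]])
next
  case (Suc n)
  \<comment> \<open>Projection commutes with preimage because the square formed by
    \<open>forget_last m\<close> and the maps induced by \<open>f\<close> is a pullback.\<close>
  have *: "map_prod id f -` forget_last m ` C \<inter> topspace (baire_pow m Y) =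
      forget_last m ` (map_prod id f -` C \<inter> topspace (baire_pow (Suc m) Y))"
    if "C \<in> Pi1_pow n (Suc m) Z" for C
  proof (intro equalityI subsetI)
    fix x assume "x \<in> map_prod id f -` forget_last m ` C \<inter> topspace (baire_pow m Y)"
    then obtain s y t where x: "x = (s, y)" "y \<in> topspace Y" "(t, f y) \<in> C" "s = restrict t {..<m}"
      by (cases x) (auto simp: forget_last_def topspace_baire_pow)
    \<comment> \<open>The witness \<open>(t, y)\<close> keeps the Baire coordinates of a point of
      \<open>C\<close> over \<open>(s, f y)\<close>; extensionality of \<open>t\<close> puts it in
      the space.\<close>
    then have "t \<in> extensional {..<Suc m}"
      using Pi1_pow_subset[OF that] by (auto simp: topspace_baire_pow)
    then have "(t, y) \<in> map_prod id f -` C \<inter> topspace (baire_pow (Suc m) Y)"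
      using x by (auto simp: topspace_baire_pow)
    moreover have "x = forget_last m (t, y)"
      using x by (simp add: forget_last_def)
    ultimately show "x \<in> forget_last m ` (map_prod id f -` C \<inter> topspace (baire_pow (Suc m) Y))"
      by (rule rev_image_eqI)
  next
    fix x assume "x \<in> forget_last m ` (map_prod id f -` C \<inter> topspace (baire_pow (Suc m) Y))"
    then show "x \<in> map_prod id f -` forget_last m ` C \<inter> topspace (baire_pow m Y)"
      by (force simp: forget_last_def topspace_baire_pow)
  qed
  show ?case
    using Suc.prems unfolding Pi1_pow.simps
  proof (rule complements_vimage[OF continuous_map_baire_pow[OF f]])
    fix B assume "B \<in> (`) (forget_last m) ` Pi1_pow n (Suc m) Z"
    then obtain C where C: "C \<in> Pi1_pow n (Suc m) Z" "B = forget_last m ` C" by blast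
    show "map_prod id f -` B \<inter> topspace (baire_pow m Y)
        \<in> (`) (forget_last m) ` Pi1_pow n (Suc m) Y"
      unfolding C(2) *[OF C(1)] using Suc.IH[OF C(1)] by (rule imageI)
  qed
qed

lemma Sigma1_vimage:
  assumes f: "continuous_map Y Z f" and A: "A \<in> Sigma1 n Z"
  shows "f -` A \<inter> topspace Y \<in> Sigma1 n Y"
proof -
  obtain B where B: "A = snd ` B" "B \<in> Pi1_pow (n - 1) 1 Z"
    using A by (auto simp: Sigma1_def)
  have "f -` A \<inter> topspace Y = snd ` (map_prod id f -` B \<inter> topspace (baire_pow 1 Y))"
    using Pi1_pow_subset[OF B(2)] by (force simp: B(1) topspace_baire_pow)
  then show ?thesis
    using Pi1_pow_vimage[OF f B(2)] unfolding Sigma1_def by blast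
qed

lemma pointclass_vimage:
  assumes f: "continuous_map Y Z f" and A: "A \<in> pointclass \<Gamma> Z"
  shows "f -` A \<inter> topspace Y \<in> pointclass \<Gamma> Y"
  using A
  by (cases \<Gamma>)
    (auto simp: Pi0_def PiD_def Pi1_def Sigma0_vimage[OF f] SigmaD_vimage[OF f] Sigma1_vimage[OF f]
      intro: complements_vimage[OF f])

section \<open>Traces on subspaces\<close>

text \<open>Restriction to a subspace is the preimage under the inclusion; this section supplies the
  opposite direction, extending sets from \<open>S\<close>. Here the complement of an extension
  extends the complement.\<close>

lemma complements_subtopology:
  assumes "A \<in> complements (subtopology Y S) C"
    and "\<And>B. B \<in> C \<Longrightarrow> \<exists>B'\<in>C'. B = B' \<inter> S"
  shows "\<exists>A'\<in>complements Y C'. A = A' \<inter> S"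
proof -
  obtain B where B: "B \<in> C" "A = topspace Y \<inter> S - B"
    using assms(1) by (auto simp: complements_def)
  obtain B' where "B' \<in> C'" "B = B' \<inter> S" using assms(2)[OF B(1)] by blast
  then show ?thesis using B(2) by (auto simp: complements_def)
qed

text \<open>Choosing a single extension for each member keeps the family countable. With
  \<open>P\<close> and \<open>Q\<close> general, this covers level two as well as the higher Borel
  levels.\<close>

lemma countable_Union_subtopology:
  assumes C: "countable C" "C \<subseteq> P" and P: "\<And>B. B \<in> P \<Longrightarrow> \<exists>B'\<in>Q. B = B' \<inter> S"
  shows "\<exists>C'. countable C' \<and> C' \<subseteq> Q \<and> \<Union>C = \<Union>C' \<inter> S"
proof -
  obtain h where h: "\<And>B. B \<in> P \<Longrightarrow> h B \<in> Q \<and> B = h B \<inter> S" using P by metis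
  then have "\<Union>C = \<Union>(h ` C) \<inter> S" using C(2) by fast
  then show ?thesis using C h by (intro exI[of _ "h ` C"]) auto
qed

lemma bool_comb_subtopology:
  assumes "A \<in> bool_comb (subtopology Y S)"
  shows "\<exists>B\<in>bool_comb Y. A = B \<inter> S"
  using assms
proof (induction rule: bool_comb.induct)
  case (opn U)
  then show ?case by (auto simp: openin_subtopology intro: bool_comb.opn)
next
  case (compl A)
  then obtain B where "B \<in> bool_comb Y" "A = B \<inter> S" by blast
  then show ?case by (intro bexI[of _ "topspace Y - B"]) (auto intro: bool_comb.compl)
next
  case (union A A')
  then obtain B B' where "B \<in> bool_comb Y" "A = B \<inter> S" "B' \<in> bool_comb Y" "A' = B' \<inter> S" by blast
  then show ?case by (intro bexI[of _ "B \<union> B'"]) (auto intro: bool_comb.union)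
next
  case (inter A A')
  then obtain B B' where "B \<in> bool_comb Y" "A = B \<inter> S" "B' \<in> bool_comb Y" "A' = B' \<inter> S" by blast
  then show ?case by (intro bexI[of _ "B \<inter> B'"]) (auto intro: bool_comb.inter)
qed

text \<open>Level one is the definition of the subspace topology, and traces commute with the
  operations that build the later levels. Nothing is asked of \<open>S\<close>, as the domain of a
  partial continuous function may be any set.\<close>

lemma Sigma0_subtopology:
  assumes "A \<in> Sigma0 \<alpha> (subtopology Y S)"
  shows "\<exists>B\<in>Sigma0 \<alpha> Y. A = B \<inter> S"
  using assms
proof (induction \<alpha> arbitrary: A rule: less_induct)
  case (less \<alpha>)
  consider "\<alpha> = 0" | "\<alpha> \<noteq> 0" "\<alpha> = osuc 0" | "\<alpha> = osuc (osuc 0)"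
    | "\<alpha> \<noteq> 0" "\<alpha> \<noteq> osuc 0" "\<alpha> \<noteq> osuc (osuc 0)" by blast
  then show ?case
  proof cases
    case 1
    then show ?thesis using less.prems by (simp add: Sigma0.simps)
  next
    case 2
    then have "openin (subtopology Y S) A" using less.prems by (subst (asm) Sigma0.simps) simp
    then show ?thesis using 2 by (subst Sigma0.simps) (auto simp: openin_subtopology)
  next
    case 3
    then obtain C where C: "A = \<Union>C" "countable C" "C \<subseteq> bool_comb (subtopology Y S)"
      using less.prems unfolding 3 Sigma0_two by blast
    obtain C' where "countable C'" "C' \<subseteq> bool_comb Y" "A = \<Union>C' \<inter> S"
      using countable_Union_subtopology[OF C(2,3) bool_comb_subtopology] C(1) by metis
    then show ?thesis unfolding 3 Sigma0_two by blast
  next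
    case 4
    then obtain C where C: "A = \<Union>C" "countable C"
        "C \<subseteq> (\<Union>\<beta>\<in>{..<\<alpha>}. complements (subtopology Y S) (Sigma0 \<beta> (subtopology Y S)))"
      using less.prems unfolding Sigma0_greater_two[OF 4] by blast
    have "\<exists>B'\<in>(\<Union>\<beta>\<in>{..<\<alpha>}. complements Y (Sigma0 \<beta> Y)). B = B' \<inter> S"
      if B: "B \<in> (\<Union>\<beta>\<in>{..<\<alpha>}. complements (subtopology Y S) (Sigma0 \<beta> (subtopology Y S)))" for B
    proof -
      obtain \<beta> where \<beta>: "\<beta> < \<alpha>" "B \<in> complements (subtopology Y S) (Sigma0 \<beta> (subtopology Y S))"
        using B by auto
      then show ?thesis
        using complements_subtopology[OF \<beta>(2) less.IH[OF \<beta>(1)]] by blast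
    qed
    from countable_Union_subtopology[OF C(2,3) this] obtain C' where "countable C'"
        "C' \<subseteq> (\<Union>\<beta>\<in>{..<\<alpha>}. complements Y (Sigma0 \<beta> Y))" "A = \<Union>C' \<inter> S"
      using C(1) by metis
    then show ?thesis unfolding Sigma0_greater_two[OF 4] by blast
  qed
qed

lemma SigmaD_subtopology:
  assumes "A \<in> SigmaD \<theta> \<alpha> (subtopology Y S)"
  shows "\<exists>B\<in>SigmaD \<theta> \<alpha> Y. A = B \<inter> S"
proof -
  obtain F where F: "A = diff_op \<alpha> F" "\<forall>\<beta><\<alpha>. F \<beta> \<in> Sigma0 \<theta> (subtopology Y S)"
    using assms by (auto simp: SigmaD_def)
  \<comment> \<open>\<open>F\<close> is unconstrained from \<alpha> on, so the bound is put inside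
    the quantifier before choosing the extensions.\<close>
  have "\<forall>\<beta>. \<exists>B. \<beta> < \<alpha> \<longrightarrow> B \<in> Sigma0 \<theta> Y \<and> F \<beta> = B \<inter> S"
    using F(2) Sigma0_subtopology by blast
  then obtain G where G: "\<And>\<beta>. \<beta> < \<alpha> \<Longrightarrow> G \<beta> \<in> Sigma0 \<theta> Y"
      "\<And>\<beta>. \<beta> < \<alpha> \<Longrightarrow> F \<beta> = G \<beta> \<inter> S"
    unfolding choice_iff by blast
  have "F \<beta> - (\<Union>\<gamma>\<in>{..<\<beta>}. F \<gamma>) = (G \<beta> - (\<Union>\<gamma>\<in>{..<\<beta>}. G \<gamma>)) \<inter> S" if "\<beta> < \<alpha>" for \<beta>
  proof -
    \<comment> \<open>Each \<gamma> below \<beta> is also below \<alpha>, where \<open>G\<close>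
      extends \<open>F\<close>.\<close>
    have "(\<Union>\<gamma>\<in>{..<\<beta>}. F \<gamma>) = (\<Union>\<gamma>\<in>{..<\<beta>}. G \<gamma> \<inter> S)"
      using that by (intro SUP_cong refl G(2)) (simp add: less_trans)
    then show ?thesis unfolding G(2)[OF that] by blast
  qed
  then have "A = (\<Union>\<beta>\<in>{\<beta>. \<beta> < \<alpha> \<and> ord_parity \<beta> \<noteq> ord_parity \<alpha>}.
      (G \<beta> - (\<Union>\<gamma>\<in>{..<\<beta>}. G \<gamma>)) \<inter> S)"
    unfolding F(1) diff_op_def by (intro SUP_cong refl) simp
  then have "A = diff_op \<alpha> G \<inter> S"
    by (simp only: diff_op_def Int_UN_distrib2) blast
  moreover have "diff_op \<alpha> G \<in> SigmaD \<theta> \<alpha> Y"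
    unfolding SigmaD_def using G(1) by blast
  ultimately show ?thesis by blast
qed

lemma baire_pow_subtopology:
  "baire_pow m (subtopology Y S) = subtopology (baire_pow m Y) (UNIV \<times> S)"
  by (simp add: baire_pow_def subtopology_Times)

lemma Pi1_pow_subtopology:
  assumes "A \<in> Pi1_pow n m (subtopology Y S)"
  shows "\<exists>B\<in>Pi1_pow n m Y. A = B \<inter> (UNIV \<times> S)"
  using assms
proof (induction n arbitrary: m A)
  case 0
  then show ?case
    unfolding Pi1_pow.simps Pi0_def baire_pow_subtopology
    by (rule complements_subtopology[OF _ Sigma0_subtopology])
next
  case (Suc n)
  \<comment> \<open>\<open>forget_last\<close> keeps the base point, and membership in
    \<open>UNIV \<times> S\<close> is decided by the base point alone.\<close>
  have *: "forget_last m ` (C \<inter> (UNIV \<times> S)) = forget_last m ` C \<inter> (UNIV \<times> S)" for C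
    by (force simp: forget_last_def)
  show ?case
    using Suc.prems unfolding Pi1_pow.simps baire_pow_subtopology
  proof (rule complements_subtopology)
    fix B assume "B \<in> (`) (forget_last m) ` Pi1_pow n (Suc m) (subtopology Y S)"
    then obtain C where C: "C \<in> Pi1_pow n (Suc m) (subtopology Y S)" "B = forget_last m ` C"
      by blast
    obtain C' where C': "C' \<in> Pi1_pow n (Suc m) Y" "C = C' \<inter> (UNIV \<times> S)"
      using Suc.IH[OF C(1)] by blast
    show "\<exists>B'\<in>(`) (forget_last m) ` Pi1_pow n (Suc m) Y. B = B' \<inter> (UNIV \<times> S)"
      using C' by (intro bexI[of _ "forget_last m ` C'"]) (simp_all only: C(2) * imageI)
  qed
qed

lemma Sigma1_subtopology:
  assumes "A \<in> Sigma1 n (subtopology Y S)"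
  shows "\<exists>B\<in>Sigma1 n Y. A = B \<inter> S"
proof -
  obtain C where C: "A = snd ` C" "C \<in> Pi1_pow (n - 1) 1 (subtopology Y S)"
    using assms by (auto simp: Sigma1_def)
  obtain C' where "C' \<in> Pi1_pow (n - 1) 1 Y" "C = C' \<inter> (UNIV \<times> S)"
    using Pi1_pow_subtopology[OF C(2)] by blast
  moreover from this have "A = snd ` C' \<inter> S" by (force simp: C(1))
  ultimately show ?thesis unfolding Sigma1_def by blast
qed

lemma pointclass_subtopology:
  assumes "A \<in> pointclass \<Gamma> (subtopology Y S)"
  shows "\<exists>B\<in>pointclass \<Gamma> Y. A = B \<inter> S"
  using assms
  by (cases \<Gamma>)
    (auto simp: Pi0_def PiD_def Pi1_def
      dest: Sigma0_subtopology SigmaD_subtopology Sigma1_subtopology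
      complements_subtopology[OF _ Sigma0_subtopology]
      complements_subtopology[OF _ SigmaD_subtopology]
      complements_subtopology[OF _ Sigma1_subtopology])

section \<open>Precompleteness\<close>

text \<open>This allows the intersections with \<open>topspace\<close> carried by preimages and
  traces to be dropped when sections are compared.\<close>

lemma pointclass_subset:
  assumes "A \<in> pointclass \<Gamma> Y"
  shows "A \<subseteq> topspace Y"
proof -
  have "A \<subseteq> topspace Y" if "A \<in> SigmaD \<theta> \<alpha> Y" for \<theta> \<alpha>
    using that Sigma0_subset by (fastforce simp: SigmaD_def diff_op_def)
  moreover have "A \<subseteq> topspace Y" if "A \<in> Sigma1 n Y" for n
    using that Pi1_pow_subset by (fastforce simp: Sigma1_def topspace_baire_pow)
  ultimately show ?thesis
    using assms
    by (cases \<Gamma>) (auto simp: Pi0_def PiD_def Pi1_def complements_def dest: Sigma0_subset)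
qed

text \<open>The graph of the section map is \<open>V\<close> itself, and each section is the
  preimage of \<open>V\<close> under the continuous map \<open>Pair a\<close>.\<close>

lemma is_TR_of_sections:
  assumes "V \<in> pointclass \<Gamma> (prod_topology baire X)"
  shows "is_TR_of \<Gamma> X (\<lambda>a. {x. (a, x) \<in> V})"
proof -
  have "{x. (a, x) \<in> V} \<in> pointclass \<Gamma> X" for a
  proof -
    have "{x. (a, x) \<in> V} = Pair a -` V \<inter> topspace X"
      using pointclass_subset[OF assms] by auto
    moreover have "continuous_map X (prod_topology baire X) (Pair a)"
      by (simp add: continuous_map_paired)
    ultimately show ?thesis using pointclass_vimage assms by metis
  qed
  then show ?thesis using assms by (simp add: is_TR_of_def)
qed

theorem theorem6p5:
  fixes X :: "'a topology" and \<Gamma> :: family and \<nu> :: "(nat \<Rightarrow> nat) \<Rightarrow> 'a set"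
  assumes "second_countable X"
    and "admissible \<Gamma>"
    and "principal_TR_of \<Gamma> X \<nu>"
  shows "precomplete \<nu>"
  unfolding precomplete_def
proof (intro allI impI)
  fix S :: "baire set" and \<psi> :: "baire \<Rightarrow> baire"
  assume \<psi>: "continuous_map (subtopology baire S) baire \<psi>"
  let ?U = "{(a, x). x \<in> \<nu> a}"
  have \<nu>: "\<nu> a \<in> pointclass \<Gamma> X" "?U \<in> pointclass \<Gamma> (prod_topology baire X)" for a
    using assms(3) by (simp_all add: principal_TR_of_def is_TR_of_def)
  let ?Z = "prod_topology (subtopology baire S) X"
  let ?W = "map_prod \<psi> id -` ?U \<inter> topspace ?Z"
  have "continuous_map ?Z (prod_topology baire X) (map_prod \<psi> id)"
    unfolding map_prod_def case_prod_unfold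
    by (auto simp: continuous_map_paired continuous_map_snd
        intro: continuous_map_compose[OF continuous_map_fst \<psi>, unfolded o_def])
  then have "?W \<in> pointclass \<Gamma> ?Z"
    using \<nu>(2) by (rule pointclass_vimage)
  \<comment> \<open>\<open>V\<close> extends the relation of \<open>x\<close> being in
    \<open>\<nu> (\<psi> a)\<close>, given only for \<open>a\<close> in \<open>S\<close>, to all of
    the Baire space; its sections off \<open>S\<close> are whatever the extension yields.\<close>
  then obtain V where V: "V \<in> pointclass \<Gamma> (prod_topology baire X)" "?W = V \<inter> (S \<times> topspace X)"
    unfolding prod_topology_subtopology(1) using pointclass_subtopology by blast
  then obtain g where g: "continuous_map baire baire g" "(\<lambda>a. {x. (a, x) \<in> V}) = \<nu> \<circ> g"
    using is_TR_of_sections assms(3) unfolding principal_TR_of_def TR_reducible_def by metis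
  have "\<nu> (\<psi> a) = \<nu> (g a)" if "a \<in> S" for a
  proof -
    have "\<nu> (g a) = {x. (a, x) \<in> V}" using fun_cong[OF g(2), of a] by simp
    \<comment> \<open>Over a point of \<open>S\<close>, cutting \<open>V\<close> down to
      \<open>S \<times> topspace X\<close> removes nothing from the section.\<close>
    also have "\<dots> = {x. (a, x) \<in> ?W}"
      unfolding V(2) using that pointclass_subset[OF V(1)] by auto
    also have "\<dots> = \<nu> (\<psi> a)"
      using that pointclass_subset[OF \<nu>(1)] by auto
    finally show ?thesis ..
  qed
  with g(1) show "\<exists>g. continuous_map baire baire g \<and> (\<forall>a\<in>S. \<nu> (\<psi> a) = \<nu> (g a))"
    by blast
qed

end
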